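(* For any upper semi-continuous $f:[0,1]\to\mathbb{R}$, the set $C_f$ of points at which $f$ is continuous is definable using $\exists^{2}$.
   Context: $\exists^{2}$ (Kleene's quantifier) is the functional $\varphi:\mathbb{N}^{\mathbb{N}}\to\{0,1\}$ with $\varphi(f)=0\leftrightarrow(\exists n)(f(n)=0)$, used within Kleene's S1–S9 higher-order computability. A function $f:[0,1]\to\mathbb{R}$ is upper semi-continuous (usco) at $x_0$ if for any $y>f(x_0)$ there is $N\in\mathbb{N}$ such that $f(z)<y$ for all $z\in B(x_0,2^{-N})$; $f$ is usco if it is usco at every point. *)

theory Defs
  imports "HOL-Analysis.Analysis" "HOL-Library.Countable"
begin

type_synonym type1 = "nat \<Rightarrow> nat"
type_synonym type2 = "type1 \<Rightarrow> nat"

definition to_front :: "nat \<Rightarrow> 'a list \<Rightarrow> 'a list" where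
  "to_front k xs = xs ! k # take k xs @ drop (Suc k) xs"

text \<open>
  Kleene's schemes S1--S9 for arguments of pure type at most 2:
  \<open>kleene e ns fs Fs m\<close> reads \<open>{e}(ns, fs, Fs) = m\<close>, where the arguments are grouped by type
  (as in Kleene's formulation, only the order within each type matters).
  No computation from such arguments ever introduces an argument of a higher type: the only
  new arguments are the numbers supplied by S4, S5 and the bound variable of S8. So this is
  the full S1--S9 relation on such arguments.
  The index of a computation is the code of a list headed by the number of the scheme.
\<close>

inductive kleene :: "nat \<Rightarrow> nat list \<Rightarrow> type1 list \<Rightarrow> type2 list \<Rightarrow> nat \<Rightarrow> bool" where
  S1: "kleene (list_encode [1]) (n # ns) fs Fs (Suc n)"
| S2: "kleene (list_encode [2, q]) ns fs Fs q"
| S3: "kleene (list_encode [3]) (n # ns) fs Fs n"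
| S4: "kleene d ns fs Fs m \<Longrightarrow> kleene c (m # ns) fs Fs r
        \<Longrightarrow> kleene (list_encode [4, c, d]) ns fs Fs r"
| S5_zero: "kleene c ns fs Fs r \<Longrightarrow> kleene (list_encode [5, c, d]) (0 # ns) fs Fs r"
| S5_Suc: "kleene (list_encode [5, c, d]) (n # ns) fs Fs m \<Longrightarrow> kleene d (n # m # ns) fs Fs r
        \<Longrightarrow> kleene (list_encode [5, c, d]) (Suc n # ns) fs Fs r"
| S6_0: "k < length ns \<Longrightarrow> kleene d (to_front k ns) fs Fs r
        \<Longrightarrow> kleene (list_encode [6, 0, k, d]) ns fs Fs r"
| S6_1: "k < length fs \<Longrightarrow> kleene d ns (to_front k fs) Fs r
        \<Longrightarrow> kleene (list_encode [6, 1, k, d]) ns fs Fs r"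
| S6_2: "k < length Fs \<Longrightarrow> kleene d ns fs (to_front k Fs) r
        \<Longrightarrow> kleene (list_encode [6, 2, k, d]) ns fs Fs r"
| S7: "kleene (list_encode [7]) (n # ns) (f # fs) Fs (f n)"
| S8: "(\<And>n. kleene d (n # ns) fs (F # Fs) (g n))
        \<Longrightarrow> kleene (list_encode [8, d]) ns fs (F # Fs) (F g)"
| S9: "kleene a ns fs Fs r
        \<Longrightarrow> kleene (list_encode [9, length ns, length fs, length Fs])
              (a # ns @ ns') (fs @ fs') (Fs @ Fs') r"

lemma kleene_unique: "kleene e ns fs Fs m \<Longrightarrow> kleene e ns fs Fs m' \<Longrightarrow> m = m'"
proof (induction arbitrary: m' rule: kleene.induct)
  case (S8 d ns fs F Fs g)
  from S8.prems obtain g' where "m' = F g'" "\<And>n. kleene d (n # ns) fs (F # Fs) (g' n)"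
    by (cases rule: kleene.cases) (simp_all add: list_encode_eq del: list_encode.simps)
  with S8.IH show ?case by (metis ext)
next
  case (S4 d ns fs Fs m c r)
  from S4.prems obtain k where "kleene d ns fs Fs k" "kleene c (k # ns) fs Fs m'"
    by (cases rule: kleene.cases) (simp_all add: list_encode_eq del: list_encode.simps)
  with S4.IH show ?case by metis
next
  case (S5_Suc c d n ns fs Fs m r)
  from S5_Suc.prems obtain k where "kleene (list_encode [5, c, d]) (n # ns) fs Fs k"
      "kleene d (n # k # ns) fs Fs m'"
    by (cases rule: kleene.cases) (simp_all add: list_encode_eq del: list_encode.simps)
  with S5_Suc.IH show ?case by metis
next
  case (S5_zero c ns fs Fs r d)
  from S5_zero.prems have "kleene c ns fs Fs m'"
    by (cases rule: kleene.cases) (simp_all add: list_encode_eq del: list_encode.simps)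
  with S5_zero.IH show ?case .
next
  case (S6_0 k ns d fs Fs r)
  from S6_0.prems have "kleene d (to_front k ns) fs Fs m'"
    by (cases rule: kleene.cases) (simp_all add: list_encode_eq del: list_encode.simps)
  with S6_0.IH show ?case .
next
  case (S6_1 k fs d ns Fs r)
  from S6_1.prems have "kleene d ns (to_front k fs) Fs m'"
    by (cases rule: kleene.cases) (simp_all add: list_encode_eq del: list_encode.simps)
  with S6_1.IH show ?case .
next
  case (S6_2 k Fs d ns fs r)
  from S6_2.prems have "kleene d ns fs (to_front k Fs) m'"
    by (cases rule: kleene.cases) (simp_all add: list_encode_eq del: list_encode.simps)
  with S6_2.IH show ?case .
next
  case (S9 a ns fs Fs r ns' fs' Fs')
  from S9.prems have "kleene a ns fs Fs m'"
    by (cases rule: kleene.cases) (simp_all add: list_encode_eq del: list_encode.simps)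
  with S9.IH show ?case .
qed (erule kleene.cases; simp add: list_encode_eq del: list_encode.simps)+

definition E2 :: type2 where
  "E2 f = (if \<exists>n. f n = 0 then 0 else 1)"

text \<open>A type-1 object codes a real by a fast converging Cauchy sequence of rationals.\<close>

definition codes_real :: "type1 \<Rightarrow> real \<Rightarrow> bool" where
  "codes_real x r \<longleftrightarrow>
     (let q = (\<lambda>n. real_of_rat (nat_to_rat_surj (x n)))
      in (\<forall>n i. \<bar>q n - q (n + i)\<bar> < 1 / 2 ^ n) \<and> q \<longlonglongrightarrow> r)"

text \<open>
  An object of type \<open>1 \<rightarrow> 1\<close> represents a function on \<open>[0,1]\<close> if it maps every code of
  \<open>r \<in> [0,1]\<close> to some code of \<open>f r\<close>; in particular it respects equality of reals.
\<close>

definition represents :: "(type1 \<Rightarrow> type1) \<Rightarrow> (real \<Rightarrow> real) \<Rightarrow> bool" where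
  "represents \<Phi> f \<longleftrightarrow> (\<forall>r\<in>{0..1}. \<forall>x. codes_real x r \<longrightarrow> codes_real (\<Phi> x) (f r))"

text \<open>The usual reduction of type \<open>1 \<rightarrow> 1\<close> to pure type 2: uncurry and merge the arguments.\<close>

definition pure2 :: "(type1 \<Rightarrow> type1) \<Rightarrow> type2" where
  "pure2 \<Phi> g = \<Phi> (\<lambda>i. g (Suc i)) (g 0)"

definition usco_at :: "(real \<Rightarrow> real) \<Rightarrow> real \<Rightarrow> bool" where
  "usco_at f x0 \<longleftrightarrow> (\<forall>y > f x0. \<exists>N::nat. \<forall>z \<in> ball x0 (1 / 2 ^ N) \<inter> {0..1}. f z < y)"

definition usco :: "(real \<Rightarrow> real) \<Rightarrow> bool" where
  "usco f \<longleftrightarrow> (\<forall>x0\<in>{0..1}. usco_at f x0)"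

definition cont_points :: "(real \<Rightarrow> real) \<Rightarrow> real set" where
  "cont_points f = {x \<in> {0..1}. continuous (at x within {0..1}) f}"

text \<open>The characteristic functional of a set of reals, on codes; it is 0 on non-codes.\<close>

definition char_fun :: "real set \<Rightarrow> type2" where
  "char_fun X x = (if \<exists>r\<in>X. codes_real x r then 1 else 0)"

end

theory Submission
  imports Defs
begin

text \<open>
  A usco function satisfies \<open>f z \<ge> c\<close> as soon as \<open>f q \<ge> c\<close> for rational \<open>q\<close> arbitrarily close to \<open>z\<close>.
  Hence it is continuous at \<open>r\<close> iff for every \<open>k\<close> there is \<open>N\<close> such that \<open>f r \<le> f q + 2\<^sup>-\<^sup>k\<close> for all
  rational \<open>q \<in> [0,1]\<close> within about \<open>2\<^sup>-\<^sup>N\<close> of \<open>r\<close>. This condition quantifies over numbers only, and so does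
  the comparison of two coded reals; \<open>\<exists>\<^sup>2\<close> decides every such quantifier.
\<close>

section \<open>Computability from \<open>E2\<close> and a type-2 argument\<close>

text \<open>
  The number arguments are given by an environment \<open>v\<close>, of which only \<open>v 0, \<dots>, v (k - 1)\<close> are passed.
  A bound number is pushed in front of it, so that inside a binder \<open>v 0\<close> is the bound
  variable and \<open>v (Suc i)\<close> the former \<open>v i\<close>.
\<close>

definition kcomp :: "nat \<Rightarrow> (type1 \<Rightarrow> type2 \<Rightarrow> (nat \<Rightarrow> nat) \<Rightarrow> nat) \<Rightarrow> bool" where
  "kcomp k h \<longleftrightarrow> (\<exists>e. \<forall>x F v. kleene e (map v [0..<k]) [x] [E2, F] (h x F v))"

lemma map_case_nat_upt: "map (case_nat a v) [0..<Suc k] = a # map v [0..<k]"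
  by (simp add: map_upt_Suc del: upt_Suc)

lemma kcomp_const: "kcomp k (\<lambda>x F v. c)"
  unfolding kcomp_def using kleene.S2 by blast

text \<open>S6 moves the chosen number to the front, where S3 projects it.\<close>

lemma kleene_nth: "i < length ns \<Longrightarrow> kleene (list_encode [6, 0, i, list_encode [3]]) ns fs Fs (ns ! i)"
  by (rule kleene.S6_0) (auto simp: to_front_def simp del: list_encode.simps intro: kleene.S3)

lemma kcomp_var:
  assumes "i < k"
  shows "kcomp k (\<lambda>x F v. v i)"
proof -
  have "kleene (list_encode [6, 0, i, list_encode [3]]) (map v [0..<k]) fs Fs (v i)" for v fs Fs
    using kleene_nth[of i "map v [0..<k]"] assms by (simp del: list_encode.simps)
  then show ?thesis unfolding kcomp_def by blast
qed

text \<open>S4 puts the value of \<open>t\<close> in front of the numbers, just as binding a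
  variable does. Schemes that act on the first number thereby apply to any computable
  argument.\<close>

lemma kcomp_let:
  assumes "kcomp k t" and "kcomp (Suc k) (\<lambda>x F v. P x F (\<lambda>i. v (Suc i)) (v 0))"
  shows "kcomp k (\<lambda>x F v. P x F v (t x F v))"
proof -
  obtain d where d: "\<And>x F v. kleene d (map v [0..<k]) [x] [E2, F] (t x F v)"
    using assms(1) unfolding kcomp_def by blast
  obtain c where c: "\<And>x F v. kleene c (map v [0..<Suc k]) [x] [E2, F] (P x F (\<lambda>i. v (Suc i)) (v 0))"
    using assms(2) unfolding kcomp_def by blast
  have "kleene c (t x F v # map v [0..<k]) [x] [E2, F] (P x F v (t x F v))" for x F v
    using c[of "case_nat (t x F v) v" x F] by (simp only: map_case_nat_upt nat.case)
  with d have "kleene (list_encode [4, c, d]) (map v [0..<k]) [x] [E2, F] (P x F v (t x F v))" for x F v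
    by (rule kleene.S4)
  then show ?thesis unfolding kcomp_def by blast
qed

text \<open>Each S4 pushes one copy; the entries of \<open>is\<close> are pushed from the last to
  the first.\<close>

lemma kleene_push_nths:
  assumes "\<forall>i\<in>set is. i < l"
  shows "\<exists>e'. \<forall>ns fs Fs r. length ns = l \<longrightarrow> kleene e (map (nth ns) is @ ns) fs Fs r \<longrightarrow> kleene e' ns fs Fs r"
  using assms
proof (induction "is" arbitrary: e)
  case (Cons i "is")
  \<comment> \<open>When \<open>i\<close> is fetched, the copies for the tail already precede
    \<open>ns\<close>, hence the offset \<open>length is\<close>.\<close>
  let ?d = "list_encode [6, 0, length is + i, list_encode [3]]"
  obtain e' where e': "\<And>ns fs Fs r. length ns = l \<Longrightarrow>
      kleene (list_encode [4, e, ?d]) (map (nth ns) is @ ns) fs Fs r \<Longrightarrow> kleene e' ns fs Fs r"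
    using Cons.IH Cons.prems by (meson list.set_intros(2))
  have "kleene e' ns fs Fs r"
    if "length ns = l" "kleene e (map (nth ns) (i # is) @ ns) fs Fs r" for ns fs Fs r
  proof (rule e'[OF that(1)], rule kleene.S4)
    show "kleene ?d (map (nth ns) is @ ns) fs Fs (ns ! i)"
      using kleene_nth[of "length is + i" "map (nth ns) is @ ns" fs Fs] that(1) Cons.prems
      by (simp add: nth_append del: list_encode.simps)
  qed (use that(2) in simp)
  then show ?case by blast
qed auto

text \<open>The renamed variables are copied to the front by S4; S9 then discards the original ones.\<close>

lemma kcomp_rename:
  assumes "kcomp k h" and s: "\<And>i. i < k \<Longrightarrow> s i < l"
  shows "kcomp l (\<lambda>x F v. h x F (\<lambda>i. v (s i)))"
proof -
  obtain e where e: "\<And>x F v. kleene e (map v [0..<k]) [x] [E2, F] (h x F v)"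
    using assms(1) unfolding kcomp_def by blast
  \<comment> \<open>S9 keeps \<open>k\<close> numbers, the function \<open>x\<close> and the two
    functionals; it finds the index \<open>e\<close> in front of the numbers, put there by
    \<open>?b\<close>.\<close>
  let ?c = "list_encode [9, k, 1, 2]"
  let ?b = "list_encode [4, ?c, list_encode [2, e]]"
  have "\<forall>i\<in>set (map s [0..<k]). i < l" using s by auto
  from kleene_push_nths[OF this, of ?b]
  obtain e' where e': "\<And>ns fs Fs r. length ns = l \<Longrightarrow>
      kleene ?b (map (nth ns) (map s [0..<k]) @ ns) fs Fs r \<Longrightarrow> kleene e' ns fs Fs r"
    by blast
  have "kleene e' (map v [0..<l]) [x] [E2, F] (h x F (\<lambda>i. v (s i)))" for x F v
  proof (rule e', simp, rule kleene.S4, rule kleene.S2)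
    let ?ns = "map v [0..<l]"
    have eq: "map (nth ?ns) (map s [0..<k]) = map (\<lambda>i. v (s i)) [0..<k]"
      using s by simp
    show "kleene ?c (e # map (nth ?ns) (map s [0..<k]) @ ?ns) [x] [E2, F] (h x F (\<lambda>i. v (s i)))"
      using kleene.S9[OF e[of "\<lambda>i. v (s i)" x F], of ?ns "[]" "[]"] unfolding eq
      by (simp del: list_encode.simps add: numeral_2_eq_2)
  qed
  then show ?thesis unfolding kcomp_def by blast
qed

lemma kcomp_weaken: "kcomp k h \<Longrightarrow> kcomp (Suc k) (\<lambda>x F v. h x F (\<lambda>i. v (Suc i)))"
  by (rule kcomp_rename[where s = Suc]) auto

text \<open>The step of S5 receives the counter first and the previous value second: these are
  \<open>v 0\<close> and \<open>v 1\<close>.\<close>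

lemma kcomp_rec:
  assumes "kcomp k g" and "kcomp (Suc (Suc k)) (\<lambda>x F v. s x F (\<lambda>i. v (Suc (Suc i))) (v 0) (v 1))"
    and "kcomp k t"
  shows "kcomp k (\<lambda>x F v. rec_nat (g x F v) (s x F v) (t x F v))"
proof (rule kcomp_let[OF assms(3)])
  obtain c where c: "\<And>x F v. kleene c (map v [0..<k]) [x] [E2, F] (g x F v)"
    using assms(1) unfolding kcomp_def by blast
  obtain d where "\<And>x F v. kleene d (map v [0..<Suc (Suc k)]) [x] [E2, F] (s x F (\<lambda>i. v (Suc (Suc i))) (v 0) (v 1))"
    using assms(2) unfolding kcomp_def by blast
  from this[of "case_nat n (case_nat m v)" for n m v]
  have d: "kleene d (n # m # map v [0..<k]) [x] [E2, F] (s x F v n m)" for n m v x F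
    by (simp only: map_case_nat_upt nat.case One_nat_def)
  have "kleene (list_encode [5, c, d]) (n # map v [0..<k]) [x] [E2, F] (rec_nat (g x F v) (s x F v) n)" for n v x F
  proof (induction n)
    case 0
    show ?case using kleene.S5_zero[OF c] by simp
  next
    case (Suc n)
    show ?case using kleene.S5_Suc[OF Suc d] by simp
  qed
  from this[of "v 0" "\<lambda>i. v (Suc i)" for v]
  have "kleene (list_encode [5, c, d]) (map v [0..<Suc k]) [x] [E2, F]
      (rec_nat (g x F (\<lambda>i. v (Suc i))) (s x F (\<lambda>i. v (Suc i))) (v 0))" for v x F
    by (simp only: map_upt_Suc)
  then show "kcomp (Suc k) (\<lambda>x F v. rec_nat (g x F (\<lambda>i. v (Suc i))) (s x F (\<lambda>i. v (Suc i))) (v 0))"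
    unfolding kcomp_def by blast
qed

lemma kcomp_oracle1:
  assumes "kcomp k t"
  shows "kcomp k (\<lambda>x F v. x (t x F v))"
proof (rule kcomp_let[OF assms])
  have "kleene (list_encode [7]) (map v [0..<Suc k]) [x] [E2, F] (x (v 0))" for x F v
    unfolding map_upt_Suc by (rule kleene.S7)
  then show "kcomp (Suc k) (\<lambda>x F v. x (v 0))" unfolding kcomp_def by blast
qed

text \<open>S8 applies the first functional of the list, here \<open>E2\<close>, to the function
  that the body computes from an extra first number.\<close>

lemma kcomp_E2:
  assumes "kcomp (Suc k) (\<lambda>x F v. t x F (\<lambda>i. v (Suc i)) (v 0))"
  shows "kcomp k (\<lambda>x F v. E2 (t x F v))"
proof -
  obtain d where "\<And>x F v. kleene d (map v [0..<Suc k]) [x] [E2, F] (t x F (\<lambda>i. v (Suc i)) (v 0))"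
    using assms unfolding kcomp_def by blast
  from this[of "case_nat n v" for n v]
  have "kleene d (n # map v [0..<k]) [x] [E2, F] (t x F v n)" for n v x F
    by (simp only: map_case_nat_upt nat.case)
  then have "kleene (list_encode [8, d]) (map v [0..<k]) [x] [E2, F] (E2 (t x F v))" for v x F
    by (rule kleene.S8)
  then show ?thesis unfolding kcomp_def by blast
qed

text \<open>S8 reaches only the first functional. An outer swap brings \<open>F\<close> there, and
  an inner swap restores the order \<open>E2, F\<close> for the body.\<close>

lemma kcomp_oracle2:
  assumes "kcomp (Suc k) (\<lambda>x F v. t x F (\<lambda>i. v (Suc i)) (v 0))"
  shows "kcomp k (\<lambda>x F v. F (t x F v))"
proof -
  have sw: "kleene (list_encode [6, 2, 1, d]) ns fs [G, H] r" if "kleene d ns fs [H, G] r" for d ns fs G H r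
    using that by (intro kleene.S6_2) (simp_all add: to_front_def)
  obtain d where "\<And>x F v. kleene d (map v [0..<Suc k]) [x] [E2, F] (t x F (\<lambda>i. v (Suc i)) (v 0))"
    using assms unfolding kcomp_def by blast
  from this[of "case_nat n v" for n v]
  have "kleene d (n # map v [0..<k]) [x] [E2, F] (t x F v n)" for n v x F
    by (simp only: map_case_nat_upt nat.case)
  from kleene.S8[OF sw[OF this]]
  have "kleene (list_encode [8, list_encode [6, 2, 1, d]]) (map v [0..<k]) [x] [F, E2] (F (t x F v))" for v x F .
  from sw[OF this] show ?thesis unfolding kcomp_def by blast
qed

section \<open>Arithmetic\<close>

lemma kcomp_Suc:
  assumes "kcomp k a"
  shows "kcomp k (\<lambda>x F v. Suc (a x F v))"
proof (rule kcomp_let[OF assms])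
  have "kleene (list_encode [1]) (map v [0..<Suc k]) [x] [E2, F] (Suc (v 0))" for x F v
    unfolding map_upt_Suc by (rule kleene.S1)
  then show "kcomp (Suc k) (\<lambda>x F v. Suc (v 0))" unfolding kcomp_def by blast
qed

lemma kcomp_add:
  assumes "kcomp k a" "kcomp k b"
  shows "kcomp k (\<lambda>x F v. a x F v + b x F v)"
proof -
  have eq: "m + n = rec_nat n (\<lambda>_. Suc) m" for m n :: nat by (induction m) auto
  show ?thesis unfolding eq
    by (intro kcomp_rec[OF assms(2) _ assms(1)] kcomp_Suc kcomp_var) simp
qed

lemma kcomp_mult:
  assumes "kcomp k a" "kcomp k b"
  shows "kcomp k (\<lambda>x F v. a x F v * b x F v)"
proof -
  have eq: "m * n = rec_nat 0 (\<lambda>_ r. r + n) m" for m n :: nat by (induction m) auto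
  show ?thesis unfolding eq
    by (intro kcomp_rec[OF kcomp_const _ assms(1)] kcomp_add kcomp_var
          kcomp_weaken[OF kcomp_weaken[OF assms(2)]]) simp
qed

lemma kcomp_diff:
  assumes "kcomp k a" "kcomp k b"
  shows "kcomp k (\<lambda>x F v. a x F v - b x F v)"
proof -
  \<comment> \<open>The predecessor is the recursion that starts at 0 and returns its counter;
    iterating it gives truncated subtraction.\<close>
  have pred: "m - Suc 0 = rec_nat 0 (\<lambda>n _. n) m" for m :: nat by (cases m) auto
  have "kcomp l t \<Longrightarrow> kcomp l (\<lambda>x F v. t x F v - Suc 0)" for l t
    unfolding pred by (intro kcomp_rec kcomp_const kcomp_var) simp_all
  then have "kcomp k (\<lambda>x F v. rec_nat (a x F v) (\<lambda>_ r. r - Suc 0) (b x F v))"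
    by (intro kcomp_rec[OF assms(1) _ assms(2)]) (simp add: kcomp_var)
  moreover have "rec_nat m (\<lambda>_ r. r - Suc 0) n = m - n" for m n :: nat by (induction n) auto
  ultimately show ?thesis by simp
qed

lemma kcomp_sum:
  assumes "kcomp (Suc k) (\<lambda>x F v. h x F (\<lambda>i. v (Suc i)) (v 0))" "kcomp k b"
  shows "kcomp k (\<lambda>x F v. \<Sum>i<b x F v. h x F v i)"
proof -
  have eq: "(\<Sum>i<m. g i) = rec_nat 0 (\<lambda>n r. r + g n) m" for m :: nat and g :: "nat \<Rightarrow> nat"
    by (induction m) auto
  \<comment> \<open>Inside the recursion \<open>v 1\<close> is the partial sum, so the renaming
    leaves it out of the arguments of the summand.\<close>
  have "kcomp (Suc (Suc k)) (\<lambda>x F v. h x F (\<lambda>i. v (Suc (Suc i))) (v 0))"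
    using kcomp_rename[OF assms(1), of "case_nat 0 (\<lambda>i. Suc (Suc i))" "Suc (Suc k)"]
    by (simp split: nat.splits)
  then show ?thesis unfolding eq
    by (intro kcomp_rec[OF kcomp_const _ assms(2)] kcomp_add kcomp_var) simp_all
qed

lemma kcomp_power2: "kcomp k a \<Longrightarrow> kcomp k (\<lambda>x F v. 2 ^ a x F v)"
proof -
  have eq: "2 ^ m = rec_nat (1 :: nat) (\<lambda>_ r. r + r) m" for m by (induction m) auto
  show "kcomp k a \<Longrightarrow> ?thesis" unfolding eq
    by (intro kcomp_rec kcomp_const kcomp_add kcomp_var) simp_all
qed

lemma kcomp_mod2: "kcomp k a \<Longrightarrow> kcomp k (\<lambda>x F v. a x F v mod 2)"
proof -
  have eq: "m mod 2 = rec_nat 0 (\<lambda>_ r. 1 - r) m" for m :: nat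
    by (induction m) (auto simp: mod_Suc split: if_splits)
  show "kcomp k a \<Longrightarrow> ?thesis" unfolding eq
    by (intro kcomp_rec kcomp_const kcomp_diff kcomp_var) simp_all
qed

lemma kcomp_div2: "kcomp k a \<Longrightarrow> kcomp k (\<lambda>x F v. a x F v div 2)"
proof -
  \<comment> \<open>Half of \<open>m\<close>, rounded down, counts the odd numbers below
    \<open>m\<close>.\<close>
  have eq: "m div 2 = (\<Sum>i<m. i mod 2)" for m :: nat
    by (induction m) (simp, simp, presburger)
  show "kcomp k a \<Longrightarrow> ?thesis" unfolding eq
    by (intro kcomp_sum kcomp_mod2 kcomp_var) simp_all
qed

section \<open>Decidable predicates\<close>

definition kdec :: "nat \<Rightarrow> (type1 \<Rightarrow> type2 \<Rightarrow> (nat \<Rightarrow> nat) \<Rightarrow> bool) \<Rightarrow> bool" where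
  "kdec k P \<longleftrightarrow> kcomp k (\<lambda>x F v. of_bool (P x F v))"

lemma kdec_not: "kdec k P \<Longrightarrow> kdec k (\<lambda>x F v. \<not> P x F v)"
proof -
  have eq: "of_bool (\<not> p) = 1 - (of_bool p :: nat)" for p by simp
  show "kdec k P \<Longrightarrow> ?thesis" unfolding kdec_def eq
    by (intro kcomp_diff kcomp_const)
qed

lemma kdec_conj: "kdec k P \<Longrightarrow> kdec k Q \<Longrightarrow> kdec k (\<lambda>x F v. P x F v \<and> Q x F v)"
  unfolding kdec_def of_bool_conj by (rule kcomp_mult)

lemma kdec_imp: "kdec k P \<Longrightarrow> kdec k Q \<Longrightarrow> kdec k (\<lambda>x F v. P x F v \<longrightarrow> Q x F v)"
  using kdec_not[OF kdec_conj[OF _ kdec_not]] by simp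

lemma kdec_le: "kcomp k a \<Longrightarrow> kcomp k b \<Longrightarrow> kdec k (\<lambda>x F v. a x F v \<le> b x F v)"
proof -
  have eq: "of_bool (m \<le> n) = 1 - (m - n)" for m n :: nat by simp
  show "kcomp k a \<Longrightarrow> kcomp k b \<Longrightarrow> ?thesis" unfolding kdec_def eq
    by (intro kcomp_diff kcomp_const)
qed

lemma kdec_eq: "kcomp k a \<Longrightarrow> kcomp k b \<Longrightarrow> kdec k (\<lambda>x F v. a x F v = b x F v)"
  unfolding order.eq_iff by (intro kdec_conj kdec_le)

text \<open>\<open>E2\<close> returns 0 exactly when its argument has a zero, so on a characteristic
  function it is itself the truth value of the universal quantifier.\<close>

lemma kdec_all:
  assumes "kdec (Suc k) (\<lambda>x F v. P x F (\<lambda>i. v (Suc i)) (v 0))"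
  shows "kdec k (\<lambda>x F v. \<forall>n. P x F v n)"
proof -
  have eq: "of_bool (\<forall>n. p n) = E2 (\<lambda>n. of_bool (p n))" for p
    by (simp add: E2_def)
  show ?thesis using assms unfolding kdec_def eq by (rule kcomp_E2)
qed

lemma kdec_ex:
  assumes "kdec (Suc k) (\<lambda>x F v. P x F (\<lambda>i. v (Suc i)) (v 0))"
  shows "kdec k (\<lambda>x F v. \<exists>n. P x F v n)"
  using kdec_not[OF kdec_all[OF kdec_not[OF assms]]] by simp

text \<open>Both components are bounded by the code, so exhaustive search suffices: in a double sum
  up to the code, only the pair being sought contributes.\<close>

lemma kcomp_pair_decode:
  assumes "kcomp k a"
  shows "kcomp k (\<lambda>x F v. fst (prod_decode (a x F v)))" "kcomp k (\<lambda>x F v. snd (prod_decode (a x F v)))"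
proof -
  have enc: "prod_encode (i, j) = (i + j) * Suc (i + j) div 2 + i" for i j
    by (simp add: prod_encode_def triangle_def)
  have sum: "(\<Sum>i<Suc n. \<Sum>j<Suc n. of_bool (prod_encode (i, j) = n) * g i j) = case_prod g (prod_decode n)"
    for n and g :: "nat \<Rightarrow> nat \<Rightarrow> nat"
  proof -
    obtain p q where pq: "prod_decode n = (p, q)" by fastforce
    then have n: "n = prod_encode (p, q)" by (metis prod_decode_inverse)
    have le: "p < Suc n" "q < Suc n" by (simp_all add: n le_prod_encode_1 le_prod_encode_2 less_Suc_eq_le)
    have "(\<Sum>i<Suc n. \<Sum>j<Suc n. of_bool (prod_encode (i, j) = n) * g i j)
        = (\<Sum>i<Suc n. \<Sum>j<Suc n. if j = q then (if i = p then g i j else 0) else 0)"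
      by (intro sum.cong refl) (auto simp: n prod_encode_eq)
    also have "\<dots> = g p q" using le by (simp add: sum.delta del: sum.lessThan_Suc)
    finally show ?thesis using pq by simp
  qed
  have fst: "fst (prod_decode n) = (\<Sum>i<Suc n. \<Sum>j<Suc n. of_bool ((i + j) * Suc (i + j) div 2 + i = n) * i)" for n
    using sum[of n "\<lambda>i j. i"] by (simp add: enc case_prod_beta)
  have snd: "snd (prod_decode n) = (\<Sum>i<Suc n. \<Sum>j<Suc n. of_bool ((i + j) * Suc (i + j) div 2 + i = n) * j)" for n
    using sum[of n "\<lambda>i j. j"] by (simp add: enc case_prod_beta)
  have eq: "kcomp k a \<Longrightarrow> kcomp k b \<Longrightarrow> kcomp k (\<lambda>x F v. of_bool (a x F v = b x F v))" for k a b
    using kdec_eq unfolding kdec_def .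
  note w = kcomp_weaken[OF assms] kcomp_weaken[OF kcomp_weaken[OF assms]]
  show "kcomp k (\<lambda>x F v. fst (prod_decode (a x F v)))" unfolding fst
    by (intro kcomp_sum kcomp_mult eq kcomp_add kcomp_div2 kcomp_Suc kcomp_var assms w) simp_all
  show "kcomp k (\<lambda>x F v. snd (prod_decode (a x F v)))" unfolding snd
    by (intro kcomp_sum kcomp_mult eq kcomp_add kcomp_div2 kcomp_Suc kcomp_var assms w) simp_all
qed

section \<open>Rational-valued functions\<close>

text \<open>Only naturals are computed, so a signed numerator is kept as two of them. The
  denominator is a successor, hence positive, and signs are read off the numerators.\<close>

definition kreal :: "nat \<Rightarrow> (type1 \<Rightarrow> type2 \<Rightarrow> (nat \<Rightarrow> nat) \<Rightarrow> real) \<Rightarrow> bool" where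
  "kreal k g \<longleftrightarrow> (\<exists>a b c. kcomp k a \<and> kcomp k b \<and> kcomp k c \<and>
     (\<forall>x F v. g x F v = (real (a x F v) - real (b x F v)) / real (Suc (c x F v))))"

definition val :: "nat \<Rightarrow> real" where
  "val n = real_of_rat (nat_to_rat_surj n)"

lemma krealI:
  assumes "kcomp k a" "kcomp k b" "kcomp k c"
    and "\<And>x F v. g x F v = (real (a x F v) - real (b x F v)) / real (Suc (c x F v))"
  shows "kreal k g"
  using assms unfolding kreal_def by blast

lemma kreal_0: "kreal k (\<lambda>x F v. 0)"
  by (rule krealI[OF kcomp_const[of _ 0] kcomp_const[of _ 0] kcomp_const[of _ 0]]) simp

lemma kreal_1: "kreal k (\<lambda>x F v. 1)"
  by (rule krealI[OF kcomp_const[of _ 1] kcomp_const[of _ 0] kcomp_const[of _ 0]]) simp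

lemma kreal_inverse_power2:
  assumes "kcomp k a"
  shows "kreal k (\<lambda>x F v. 1 / 2 ^ a x F v)"
proof (rule krealI[OF kcomp_const[of _ 1] kcomp_const[of _ 0] kcomp_diff[OF kcomp_power2[OF assms] kcomp_const[of _ 1]]])
  \<comment> \<open>A power of 2 is positive, so the truncated subtraction loses nothing.\<close>
  have "Suc (2 ^ n - 1) = 2 ^ n" for n :: nat by simp
  then show "1 / 2 ^ a x F v = (real 1 - real 0) / real (Suc (2 ^ a x F v - 1))" for x F v
    by (simp only:) simp
qed

lemma kreal_minus:
  assumes "kreal k g"
  shows "kreal k (\<lambda>x F v. - g x F v)"
proof -
  obtain a b c where "kcomp k a" "kcomp k b" "kcomp k c"
    and g: "\<And>x F v. g x F v = (real (a x F v) - real (b x F v)) / real (Suc (c x F v))"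
    using assms unfolding kreal_def by blast
  then show ?thesis
    by (intro krealI[of k b a c]) (simp_all only: g minus_divide_left minus_diff_eq)
qed

lemma kreal_add:
  assumes "kreal k g" "kreal k g'"
  shows "kreal k (\<lambda>x F v. g x F v + g' x F v)"
proof -
  obtain a b c where 1: "kcomp k a" "kcomp k b" "kcomp k c"
    and g: "\<And>x F v. g x F v = (real (a x F v) - real (b x F v)) / real (Suc (c x F v))"
    using assms(1) unfolding kreal_def by blast
  obtain a' b' c' where 2: "kcomp k a'" "kcomp k b'" "kcomp k c'"
    and g': "\<And>x F v. g' x F v = (real (a' x F v) - real (b' x F v)) / real (Suc (c' x F v))"
    using assms(2) unfolding kreal_def by blast
  have *: "(real p - real q) / real (Suc r) + (real p' - real q') / real (Suc r')
     = (real (p * Suc r' + p' * Suc r) - real (q * Suc r' + q' * Suc r)) / real (Suc (Suc r * Suc r' - 1))"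
    for p q r p' q' r' :: nat
  proof -
    have "Suc (Suc r * Suc r' - 1) = Suc r * Suc r'" by simp
    then show ?thesis
      by (simp only: of_nat_mult of_nat_add) (simp add: field_simps del: of_nat_Suc)
  qed
  show ?thesis
    by (rule krealI[where a = "\<lambda>x F v. a x F v * Suc (c' x F v) + a' x F v * Suc (c x F v)"
          and b = "\<lambda>x F v. b x F v * Suc (c' x F v) + b' x F v * Suc (c x F v)"
          and c = "\<lambda>x F v. Suc (c x F v) * Suc (c' x F v) - 1"])
      (intro kcomp_add kcomp_mult kcomp_diff kcomp_Suc kcomp_const 1 2 | simp only: g g' *)+
qed

lemma kreal_diff: "kreal k g \<Longrightarrow> kreal k g' \<Longrightarrow> kreal k (\<lambda>x F v. g x F v - g' x F v)"
  unfolding diff_conv_add_uminus by (intro kreal_add kreal_minus)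

lemma kdec_real_le:
  assumes "kreal k g" "kreal k g'"
  shows "kdec k (\<lambda>x F v. g x F v \<le> g' x F v)"
proof -
  have nonneg: "kdec k (\<lambda>x F v. 0 \<le> h x F v)" if h: "kreal k h" for h
  proof -
    obtain a b c where 1: "kcomp k a" "kcomp k b"
      and g: "\<And>x F v. h x F v = (real (a x F v) - real (b x F v)) / real (Suc (c x F v))"
      using h unfolding kreal_def by blast
    have "0 \<le> h x F v \<longleftrightarrow> b x F v \<le> a x F v" for x F v
      by (simp add: g zero_le_divide_iff del: of_nat_Suc)
    then show ?thesis using kdec_le[OF 1(2,1)] by simp
  qed
  show ?thesis using nonneg[OF kreal_diff[OF assms(2,1)]] by simp
qed

lemma kdec_real_less: "kreal k g \<Longrightarrow> kreal k g' \<Longrightarrow> kdec k (\<lambda>x F v. g x F v < g' x F v)"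
  using kdec_not[OF kdec_real_le] by (simp add: not_le)

lemma kdec_real_abs_less:
  "kreal k g \<Longrightarrow> kreal k g' \<Longrightarrow> kdec k (\<lambda>x F v. \<bar>g x F v\<bar> < g' x F v)"
  unfolding abs_less_iff by (intro kdec_conj kdec_real_less kreal_minus)

text \<open>
  Writing the decoded integers as \<open>P = p1 - p2\<close> and \<open>Q = q1 - q2\<close>, the fraction is
  \<open>P Q / Q\<^sup>2\<close>; this also covers \<open>Q = 0\<close>, where \<open>Fract\<close> returns 0.
\<close>

lemma kreal_val:
  assumes "kcomp k a"
  shows "kreal k (\<lambda>x F v. val (a x F v))"
proof -
  \<comment> \<open>\<open>int_decode\<close> maps even \<open>n\<close> to \<open>n div 2\<close>
    and odd \<open>n\<close> to \<open>- Suc (n div 2)\<close>; these are the positive and negative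
    parts.\<close>
  define pos where "pos n = (1 - n mod 2) * (n div 2)" for n :: nat
  define neg where "neg n = n mod 2 * Suc (n div 2)" for n :: nat
  let ?p = "\<lambda>n. fst (prod_decode n)" and ?q = "\<lambda>n. snd (prod_decode n)"
  have int: "real_of_int (int_decode n) = real (pos n) - real (neg n)" for n
    by (auto simp: int_decode_def sum_decode_def pos_def neg_def elim: evenE oddE)
  have zero: "pos n = 0 \<or> neg n = 0" for n
    by (auto simp: pos_def neg_def)
  have val: "val n = (real (pos (?p n)) - real (neg (?p n))) / (real (pos (?q n)) - real (neg (?q n)))" for n
    by (simp add: val_def nat_to_rat_surj_def case_prod_beta Fract_of_int_quotient of_rat_divide int)
  \<comment> \<open>With one part zero, \<open>q + q'\<close> is the absolute value of
    \<open>q - q'\<close>, so expanding by \<open>q - q'\<close> makes the denominator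
    nonnegative.\<close>
  have quot: "(P - P') / (real q - real q')
      = ((P * real q + P' * real q') - (P * real q' + P' * real q))
        / real (Suc ((q + q') * (q + q') - 1))"
    if "q = 0 \<or> q' = 0" for P P' :: real and q q' :: nat
  proof (cases "q = 0 \<and> q' = 0")
    case False
    then have s: "Suc ((q + q') * (q + q') - 1) = (q + q') * (q + q')" by simp
    show ?thesis unfolding s using that False by (auto simp: field_simps)
  qed simp
  have pn: "kcomp k t \<Longrightarrow> kcomp k (\<lambda>x F v. pos (t x F v))" "kcomp k t \<Longrightarrow> kcomp k (\<lambda>x F v. neg (t x F v))" for t
    unfolding pos_def neg_def
    by (intro kcomp_mult kcomp_diff kcomp_const kcomp_mod2 kcomp_div2 kcomp_Suc; assumption)+
  show ?thesis
    by (rule krealI[where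
        a = "\<lambda>x F v. pos (?p (a x F v)) * pos (?q (a x F v)) + neg (?p (a x F v)) * neg (?q (a x F v))"
        and b = "\<lambda>x F v. pos (?p (a x F v)) * neg (?q (a x F v)) + neg (?p (a x F v)) * pos (?q (a x F v))"
        and c = "\<lambda>x F v. (pos (?q (a x F v)) + neg (?q (a x F v))) * (pos (?q (a x F v)) + neg (?q (a x F v))) - 1"])
      (intro kcomp_add kcomp_mult kcomp_diff kcomp_const pn kcomp_pair_decode assms
       | simp only: val quot[OF zero] of_nat_add of_nat_mult)+
qed

section \<open>Codes of reals\<close>

lemma codes_real_val:
  "codes_real x r \<longleftrightarrow> (\<forall>n i. \<bar>val (x n) - val (x (n + i))\<bar> < 1 / 2 ^ n) \<and> (\<lambda>n. val (x n)) \<longlonglongrightarrow> r"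
  by (simp add: codes_real_def val_def)

text \<open>The strict Cauchy bound becomes non-strict when \<open>i\<close> tends to
  infinity.\<close>

lemma codes_real_abs_le:
  assumes "codes_real x r"
  shows "\<bar>val (x n) - r\<bar> \<le> 1 / 2 ^ n"
proof (rule LIMSEQ_le_const2)
  show "(\<lambda>i. \<bar>val (x n) - val (x (i + n))\<bar>) \<longlonglongrightarrow> \<bar>val (x n) - r\<bar>"
    using assms LIMSEQ_ignore_initial_segment[of "\<lambda>n. val (x n)" r n]
    by (intro tendsto_intros) (auto simp: codes_real_val)
  show "\<exists>N. \<forall>i\<ge>N. \<bar>val (x n) - val (x (i + n))\<bar> \<le> 1 / 2 ^ n"
    using assms unfolding codes_real_val by (metis add.commute less_imp_le)
qed

lemma codes_real_unique: "codes_real x r \<Longrightarrow> codes_real x s \<Longrightarrow> r = s"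
  unfolding codes_real_val using LIMSEQ_unique by blast

lemma codes_real_const: "codes_real (\<lambda>_. m) (val m)"
  by (simp add: codes_real_val)

lemma inverse_power2_tendsto_0: "(\<lambda>n. 1 / 2 ^ n :: real) \<longlonglongrightarrow> 0"
  using LIMSEQ_power_zero[of "1/2::real"] by (simp add: power_one_over)

text \<open>By completeness, the convergence demanded of a code follows from the rate condition,
  which has only number quantifiers.\<close>

lemma ex_codes_real:
  "(\<exists>r. codes_real x r) \<longleftrightarrow> (\<forall>n i. \<bar>val (x n) - val (x (n + i))\<bar> < 1 / 2 ^ n)"
proof
  assume *: "\<forall>n i. \<bar>val (x n) - val (x (n + i))\<bar> < 1 / 2 ^ n"
  have "Cauchy (\<lambda>n. val (x n))"
  proof (rule CauchyI')
    fix e :: real assume "e > 0"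
    then obtain M where M: "1 / 2 ^ M < e / 2"
      using order_tendstoD(2)[OF inverse_power2_tendsto_0, of "e/2"]
      by (auto simp: eventually_sequentially)
    have "dist (val (x m)) (val (x n)) < e" if "m \<ge> M" "n > m" for m n
    proof -
      have "\<bar>val (x M) - val (x m)\<bar> < 1 / 2 ^ M" "\<bar>val (x M) - val (x n)\<bar> < 1 / 2 ^ M"
        using *[rule_format, of M "m - M"] *[rule_format, of M "n - M"] that by simp_all
      with M show ?thesis unfolding dist_real_def by linarith
    qed
    then show "\<exists>M. \<forall>m\<ge>M. \<forall>n>m. dist (val (x m)) (val (x n)) < e" by blast
  qed
  then obtain r where "(\<lambda>n. val (x n)) \<longlonglongrightarrow> r"
    using Cauchy_convergent convergent_def by blast
  with * show "\<exists>r. codes_real x r" by (auto simp: codes_real_val)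
qed (auto simp: codes_real_val)

text \<open>Each approximation errs by at most \<open>1 / 2 ^ j\<close>; the two errors give the
  slack, which vanishes in the limit. Comparing coded reals thus takes one number
  quantifier.\<close>

lemma codes_real_le_iff:
  assumes x: "codes_real x r" and y: "codes_real y s"
  shows "r \<le> s + c \<longleftrightarrow> (\<forall>j. val (x j) \<le> val (y j) + c + (1 / 2 ^ j + 1 / 2 ^ j))"
proof
  assume "r \<le> s + c"
  show "\<forall>j. val (x j) \<le> val (y j) + c + (1 / 2 ^ j + 1 / 2 ^ j)"
  proof
    fix j show "val (x j) \<le> val (y j) + c + (1 / 2 ^ j + 1 / 2 ^ j)"
      using codes_real_abs_le[OF x, of j] codes_real_abs_le[OF y, of j] \<open>r \<le> s + c\<close> by linarith
  qed
next
  assume *: "\<forall>j. val (x j) \<le> val (y j) + c + (1 / 2 ^ j + 1 / 2 ^ j)"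
  have "(\<lambda>j. val (y j) + c + (1 / 2 ^ j + 1 / 2 ^ j)) \<longlonglongrightarrow> s + c + (0 + 0)"
    using y by (intro tendsto_intros inverse_power2_tendsto_0) (simp add: codes_real_val)
  then have "r \<le> s + c + (0 + 0)"
    using * x by (intro LIMSEQ_le[of "\<lambda>j. val (x j)"]) (auto simp: codes_real_val)
  then show "r \<le> s + c" by simp
qed

lemma codes_real_mem_unit_iff:
  assumes x: "codes_real x r"
  shows "r \<in> {0..1} \<longleftrightarrow> (\<forall>n. - (1 / 2 ^ n) \<le> val (x n) \<and> val (x n) \<le> 1 + 1 / 2 ^ n)"
proof
  assume "r \<in> {0..1}"
  show "\<forall>n. - (1 / 2 ^ n) \<le> val (x n) \<and> val (x n) \<le> 1 + 1 / 2 ^ n"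
  proof
    fix n show "- (1 / 2 ^ n) \<le> val (x n) \<and> val (x n) \<le> 1 + 1 / 2 ^ n"
      using codes_real_abs_le[OF x, of n] \<open>r \<in> {0..1}\<close> unfolding atLeastAtMost_iff by linarith
  qed
next
  assume *: "\<forall>n. - (1 / 2 ^ n) \<le> val (x n) \<and> val (x n) \<le> 1 + 1 / 2 ^ n"
  have lim: "(\<lambda>n. val (x n)) \<longlonglongrightarrow> r" using x by (simp add: codes_real_val)
  have "- 0 \<le> r"
    by (rule LIMSEQ_le[OF tendsto_minus[OF inverse_power2_tendsto_0] lim]) (use * in auto)
  moreover have "r \<le> 1 + 0"
    by (rule LIMSEQ_le[OF lim tendsto_add[OF tendsto_const inverse_power2_tendsto_0]]) (use * in auto)
  ultimately show "r \<in> {0..1}" by simp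
qed

section \<open>Continuity points of upper semi-continuous functions\<close>

lemma ex_val_between:
  assumes "a < b"
  shows "\<exists>m. a < val m \<and> val m < b"
proof -
  obtain q where "a < of_rat q" "of_rat q < b" using of_rat_dense[OF assms] by blast
  moreover obtain m where "q = nat_to_rat_surj m" using surj_nat_to_rat_surj by (metis surj_def)
  ultimately show ?thesis by (auto simp: val_def)
qed

text \<open>If \<open>f z < c\<close>, upper semi-continuity keeps \<open>f\<close> below
  \<open>c\<close> on a whole neighbourhood of \<open>z\<close>; a rational in it contradicts
  \<open>ge\<close>.\<close>

lemma usco_ge_of_val:
  assumes "usco f" and z: "z \<in> {0..1}" "\<bar>z - r\<bar> < d"
    and ge: "\<And>m. val m \<in> {0..1} \<Longrightarrow> \<bar>val m - r\<bar> < d \<Longrightarrow> c \<le> f (val m)"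
  shows "c \<le> f z"
proof (rule ccontr)
  assume "\<not> c \<le> f z"
  then obtain N :: nat where N: "\<And>w. w \<in> ball z (1 / 2 ^ N) \<Longrightarrow> w \<in> {0..1} \<Longrightarrow> f w < c"
    using assms(1) z(1) unfolding usco_def usco_at_def by (meson IntI not_le)
  \<comment> \<open>The minimum keeps the rational both in the neighbourhood of \<open>z\<close> and
    within \<open>d\<close> of \<open>r\<close>.\<close>
  define e where "e = min (1 / 2 ^ N) (d - \<bar>z - r\<bar>)"
  have e: "e > 0" using z by (simp add: e_def)
  \<comment> \<open>Clipping to the unit interval leaves a nonempty open interval even if
    \<open>z\<close> is an endpoint.\<close>
  have "max 0 (z - e) < min 1 (z + e)" using z e by auto
  then obtain m where m: "max 0 (z - e) < val m" "val m < min 1 (z + e)"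
    using ex_val_between by blast
  have "\<bar>val m - z\<bar> < e" using m by auto
  then have "val m \<in> ball z (1 / 2 ^ N)" "\<bar>val m - r\<bar> < d"
    by (auto simp: e_def dist_real_def)
  then show False using N[of "val m"] ge[of m] m by auto
qed

text \<open>The radius about \<open>val (x N)\<close> is doubled because this approximation may be
  off by \<open>1 / 2 ^ N\<close>: the window then contains every point closer to \<open>r\<close>
  than that.\<close>

lemma usco_continuous_iff:
  assumes f: "usco f" and x: "codes_real x r" and r: "r \<in> {0..1}"
  shows "continuous (at r within {0..1}) f \<longleftrightarrow>
    (\<forall>k. \<exists>N. \<forall>m. val m \<in> {0..1} \<and> \<bar>val m - val (x N)\<bar> < 1 / 2 ^ N + 1 / 2 ^ N \<longrightarrow> f r \<le> f (val m) + 1 / 2 ^ k)"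
    (is "_ \<longleftrightarrow> ?R")
proof
  assume c: "continuous (at r within {0..1}) f"
  show ?R
  proof
    fix k
    obtain d where d: "d > 0" "\<And>z. z \<in> {0..1} \<Longrightarrow> dist z r < d \<Longrightarrow> dist (f z) (f r) < 1 / 2 ^ k"
      using c[unfolded continuous_within_eps_delta, rule_format, of "1 / 2 ^ k"] by auto
    \<comment> \<open>A point of the window is closer to \<open>r\<close> than three times
      \<open>1 / 2 ^ N\<close>: twice for the radius, once for the error of
      \<open>x N\<close>.\<close>
    obtain N where N: "1 / 2 ^ N < d / 3"
      using order_tendstoD(2)[OF inverse_power2_tendsto_0, of "d/3"] d(1)
      by (auto simp: eventually_sequentially)
    have "f r \<le> f (val m) + 1 / 2 ^ k"
      if "val m \<in> {0..1}" "\<bar>val m - val (x N)\<bar> < 1 / 2 ^ N + 1 / 2 ^ N" for m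
    proof -
      have "\<bar>val m - r\<bar> < d" using codes_real_abs_le[OF x, of N] that(2) N by linarith
      then have "\<bar>f (val m) - f r\<bar> < 1 / 2 ^ k" using d(2)[OF that(1)] by (simp add: dist_real_def)
      then show ?thesis by linarith
    qed
    then show "\<exists>N. \<forall>m. val m \<in> {0..1} \<and> \<bar>val m - val (x N)\<bar> < 1 / 2 ^ N + 1 / 2 ^ N \<longrightarrow> f r \<le> f (val m) + 1 / 2 ^ k"
      by blast
  qed
next
  assume R: ?R
  show "continuous (at r within {0..1}) f"
    unfolding continuous_within_eps_delta
  proof (intro allI impI)
    fix e :: real assume e: "e > 0"
    obtain k where k: "1 / 2 ^ k < e"
      using order_tendstoD(2)[OF inverse_power2_tendsto_0 e] by (auto simp: eventually_sequentially)
    obtain N where N: "\<And>m. val m \<in> {0..1} \<Longrightarrow> \<bar>val m - val (x N)\<bar> < 1 / 2 ^ N + 1 / 2 ^ N \<Longrightarrow> f r \<le> f (val m) + 1 / 2 ^ k"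
      using R by blast
    have low: "f r - 1 / 2 ^ k \<le> f z" if "z \<in> {0..1}" "\<bar>z - r\<bar> < 1 / 2 ^ N" for z
    proof (rule usco_ge_of_val[OF f that])
      fix m assume "val m \<in> {0..1}" "\<bar>val m - r\<bar> < 1 / 2 ^ N"
      then show "f r - 1 / 2 ^ k \<le> f (val m)"
        using N[of m] codes_real_abs_le[OF x, of N] by linarith
    qed
    \<comment> \<open>Upper semi-continuity at \<open>r\<close> itself gives the other half of
      continuity.\<close>
    obtain M :: nat where M: "\<And>z. z \<in> ball r (1 / 2 ^ M) \<Longrightarrow> z \<in> {0..1} \<Longrightarrow> f z < f r + e"
      using f r e unfolding usco_def usco_at_def by (metis IntI less_add_same_cancel1)
    have "dist (f z) (f r) < e" if "z \<in> {0..1}" "dist z r < min (1 / 2 ^ N) (1 / 2 ^ M)" for z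
    proof -
      have "f r - 1 / 2 ^ k \<le> f z" "f z < f r + e"
        using that by (auto intro!: low M simp: dist_commute dist_real_def abs_minus_commute)
      then show ?thesis using k by (simp add: dist_real_def abs_less_iff)
    qed
    then show "\<exists>d>0. \<forall>z\<in>{0..1}. dist z r < d \<longrightarrow> dist (f z) (f r) < e"
      by (intro exI[of _ "min (1 / 2 ^ N) (1 / 2 ^ M)"]) auto
  qed
qed

section \<open>The continuity formula and its evaluation\<close>

text \<open>\<open>rec_nat j (\<lambda>i _. y i)\<close> is the sequence \<open>j, y 0, y 1, \<dots>\<close>, which \<open>pure2 \<Phi>\<close> maps to \<open>\<Phi> y j\<close>.\<close>

definition cont_formula :: "type1 \<Rightarrow> type2 \<Rightarrow> bool" where
  "cont_formula x F \<longleftrightarrow>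
     (\<forall>n i. \<bar>val (x n) - val (x (n + i))\<bar> < 1 / 2 ^ n) \<and>
     (\<forall>n. - (1 / 2 ^ n) \<le> val (x n) \<and> val (x n) \<le> 1 + 1 / 2 ^ n) \<and>
     (\<forall>k. \<exists>N. \<forall>m. (0 \<le> val m \<and> val m \<le> 1) \<and> \<bar>val m - val (x N)\<bar> < 1 / 2 ^ N + 1 / 2 ^ N \<longrightarrow>
        (\<forall>j. val (F (\<lambda>n. rec_nat j (\<lambda>i _. x i) n))
             \<le> val (F (\<lambda>n. rec_nat j (\<lambda>i _. m) n)) + 1 / 2 ^ k + (1 / 2 ^ j + 1 / 2 ^ j)))"

text \<open>The closure rules follow the syntax: quantifiers range over numbers and atoms compare
  rational expressions. The sequences given to \<open>F\<close> are computed by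
  \<open>kcomp_rec\<close> under the binder of \<open>kcomp_oracle2\<close>.\<close>

lemma kdec_cont_formula: "kdec 0 (\<lambda>x F v. cont_formula x F)"
  unfolding cont_formula_def
  by (intro kdec_conj kdec_all kdec_ex kdec_imp kdec_real_abs_less kdec_real_le
        kreal_add kreal_diff kreal_minus kreal_0 kreal_1 kreal_inverse_power2 kreal_val
        kcomp_oracle1 kcomp_oracle2 kcomp_rec kcomp_add kcomp_var) simp_all

text \<open>The first clause says that \<open>x\<close> is a code, the second that its real lies in
  the unit interval, and, given these, the third that \<open>f\<close> is continuous there.\<close>

lemma cont_formula_iff:
  assumes f: "usco f" and \<Phi>: "represents \<Phi> f"
  shows "cont_formula x (pure2 \<Phi>) \<longleftrightarrow> (\<exists>r\<in>cont_points f. codes_real x r)"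
proof (cases "\<exists>r. codes_real x r")
  case False
  then show ?thesis using ex_codes_real[of x] by (auto simp: cont_formula_def)
next
  case True
  then obtain r where x: "codes_real x r" by blast
  have pure2: "pure2 \<Phi> (rec_nat j (\<lambda>i _. y i)) = \<Phi> y j" for j y
    by (simp add: pure2_def)
  \<comment> \<open>\<open>\<Phi> x\<close> and \<open>\<Phi> (\<lambda>_. m)\<close> are codes of
    the two values of \<open>f\<close> being compared.\<close>
  have "f r \<le> f (val m) + c \<longleftrightarrow>
      (\<forall>j. val (\<Phi> x j) \<le> val (\<Phi> (\<lambda>_. m) j) + c + (1 / 2 ^ j + 1 / 2 ^ j))"
    if "r \<in> {0..1}" "val m \<in> {0..1}" for m c
    using \<Phi> x codes_real_const[of m] that unfolding represents_def
    by (intro codes_real_le_iff) blast+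
  then have "cont_formula x (pure2 \<Phi>) \<longleftrightarrow> r \<in> {0..1} \<and>
     (\<forall>k. \<exists>N. \<forall>m. val m \<in> {0..1} \<and> \<bar>val m - val (x N)\<bar> < 1 / 2 ^ N + 1 / 2 ^ N \<longrightarrow> f r \<le> f (val m) + 1 / 2 ^ k)"
    unfolding cont_formula_def pure2 codes_real_mem_unit_iff[OF x, symmetric] ex_codes_real[symmetric]
    using True by (simp cong: conj_cong)
  also have "\<dots> \<longleftrightarrow> r \<in> cont_points f"
    using usco_continuous_iff[OF f x] by (auto simp: cont_points_def)
  also have "\<dots> \<longleftrightarrow> (\<exists>r\<in>cont_points f. codes_real x r)"
    using x codes_real_unique by blast
  finally show ?thesis .
qed

theorem theorem5:
  shows "\<exists>e. \<forall>f \<Phi>. usco f \<longrightarrow> represents \<Phi> f \<longrightarrow>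
           (\<forall>x. kleene e [] [x] [E2, pure2 \<Phi>] (char_fun (cont_points f) x))"
proof -
  \<comment> \<open>Arity 0 leaves the empty list of numbers. The index is obtained before
    \<open>f\<close> and \<open>\<Phi>\<close> are given, so it is uniform in both.\<close>
  obtain e where e: "\<And>x F. kleene e [] [x] [E2, F] (of_bool (cont_formula x F))"
    using kdec_cont_formula unfolding kdec_def kcomp_def by auto
  have "char_fun (cont_points f) x = of_bool (cont_formula x (pure2 \<Phi>))"
    if "usco f" "represents \<Phi> f" for f \<Phi> x
    using cont_formula_iff[OF that] by (simp add: char_fun_def)
  then show ?thesis using e by metis
qed

end
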